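(* Let $\kappa$ be a regular uncountable cardinal, $\bar\lambda=\langle\lambda_i:i<\kappa\rangle$ a sequence of regular cardinals $>\kappa$, and $D$ an $\aleph_1$-complete (e.g. normal) filter on $\kappa$. Assume $\lambda$ is a regular cardinal with $\lambda=\|\bar\lambda\|_D=\mathrm{tcf}(\prod_{i<\kappa}\lambda_i/D)$. Let $\mu_i<\mathfrak{dp}^{2+}_{\lambda_i}$ for $i<\kappa$ and $\mu<\mathrm{Depth}^+(\prod_{i<\kappa}\mu_i,<_D)$. Then $\mu<\mathfrak{dp}^{2+}_\lambda$.
   Context: For an $\aleph_1$-complete filter $D$ and $f\in{}^\kappa\mathrm{Ord}$, $\|f\|_D=\bigcup\{\|g\|_D+1:g<_D f\}$ where $g<_D f$ means $\{i:g(i)<f(i)\}\in D$. $\mathrm{tcf}$ is true cofinality. For regular $\chi$, $\mathfrak{dp}^{2+}_\chi$ is the least $\nu$ such that there are no $f_\alpha\in{}^\chi\chi$ ($\alpha<\nu$) with $\alpha<\beta\Rightarrow\{i:f_\alpha(i)\ge f_\beta(i)\}$ bounded in $\chi$. $\mathrm{Depth}^+(\prod\mu_i,<_D)$ is the least $\chi$ with no sequence of length $\chi$ in $\prod\mu_i$ strictly increasing under $<_D$. *)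

theory Defs
  imports Complex_Main "HOL-Library.FuncSet"
begin

unbundle cardinal_syntax

text \<open>
  Ordinals are well-order relations, compared across types by \<open><o\<close>, \<open>\<le>o\<close>, \<open>=o\<close>; the elements of an
  ordinal \<open>r\<close> are the points of \<open>Field r\<close>. Cardinals are the relations with \<open>Card_order\<close>. A filter
  on \<open>\<kappa>\<close> is a filter on the underlying type that contains \<open>Field \<kappa>\<close>; membership of \<open>{i. P i}\<close> in
  the filter \<open>D\<close> is \<open>eventually P D\<close>.
\<close>

definition regular_cardinal :: "'a rel \<Rightarrow> bool" where
  "regular_cardinal r \<longleftrightarrow> Card_order r \<and> infinite (Field r) \<and> regularCard r"

definition filter_on :: "'k filter \<Rightarrow> 'k rel \<Rightarrow> bool" where
  "filter_on D \<kappa> \<longleftrightarrow> D \<noteq> bot \<and> eventually (\<lambda>i. i \<in> Field \<kappa>) D"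

definition aleph1_complete :: "'k filter \<Rightarrow> bool" where
  "aleph1_complete D \<longleftrightarrow>
     (\<forall>P :: nat \<Rightarrow> 'k \<Rightarrow> bool. (\<forall>n. eventually (P n) D) \<longrightarrow> eventually (\<lambda>i. \<forall>n. P n i) D)"

text \<open>
  The least ordinal with property \<open>P\<close>, among those represented on the type \<open>'a\<close>; it is unique up
  to \<open>=o\<close>. Every use below takes \<open>'a\<close> large enough for this to be the least among all ordinals:
  see \<open>ordLess_depth_plus_iff\<close> and \<open>norm_least\<close>.
\<close>

definition least_ord :: "('a rel \<Rightarrow> bool) \<Rightarrow> 'a rel" where
  "least_ord P = (SOME r. Well_order r \<and> P r \<and> (\<forall>s. Well_order s \<and> P s \<longrightarrow> r \<le>o s))"

definition strict_chain :: "'n rel \<Rightarrow> 'x set \<Rightarrow> ('x \<Rightarrow> 'x \<Rightarrow> bool) \<Rightarrow> ('n \<Rightarrow> 'x) \<Rightarrow> bool" where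
  "strict_chain \<nu> A lt F \<longleftrightarrow>
     (\<forall>a\<in>Field \<nu>. F a \<in> A) \<and> (\<forall>a b. (a, b) \<in> \<nu> \<and> a \<noteq> b \<longrightarrow> lt (F a) (F b))"

text \<open>
  For irreflexive \<open>lt\<close> a chain is injective, so the least length without a chain is at most the
  successor cardinal of the type \<open>'x\<close> and is represented on \<open>'x set\<close>.
\<close>

definition depth_plus :: "'x set \<Rightarrow> ('x \<Rightarrow> 'x \<Rightarrow> bool) \<Rightarrow> 'x set rel" where
  "depth_plus A lt = least_ord (\<lambda>\<nu>. \<not> (\<exists>F. strict_chain \<nu> A lt F))"

definition bounded_in :: "'a rel \<Rightarrow> 'a set \<Rightarrow> bool" where
  "bounded_in \<chi> S \<longleftrightarrow> (\<exists>b\<in>Field \<chi>. \<forall>i\<in>S. (i, b) \<in> \<chi>)"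

definition bd_less :: "'a rel \<Rightarrow> ('a \<Rightarrow> 'a) \<Rightarrow> ('a \<Rightarrow> 'a) \<Rightarrow> bool" where
  "bd_less \<chi> f g \<longleftrightarrow> bounded_in \<chi> {i \<in> Field \<chi>. (g i, f i) \<in> \<chi>}"

definition dp2_plus :: "'a rel \<Rightarrow> ('a \<Rightarrow> 'a) set rel" where
  "dp2_plus \<chi> = depth_plus (Field \<chi> \<rightarrow>\<^sub>E Field \<chi>) (bd_less \<chi>)"

definition ord_prod :: "'k rel \<Rightarrow> ('k \<Rightarrow> 'a rel) \<Rightarrow> ('k \<Rightarrow> 'a) set" where
  "ord_prod \<kappa> \<mu> = (\<Pi>\<^sub>E i\<in>Field \<kappa>. Field (\<mu> i))"

definition prod_le :: "'k filter \<Rightarrow> ('k \<Rightarrow> 'a rel) \<Rightarrow> ('k \<Rightarrow> 'a) \<Rightarrow> ('k \<Rightarrow> 'a) \<Rightarrow> bool" where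
  "prod_le D \<mu> x y \<longleftrightarrow> eventually (\<lambda>i. (x i, y i) \<in> \<mu> i) D"

definition prod_less :: "'k filter \<Rightarrow> ('k \<Rightarrow> 'a rel) \<Rightarrow> ('k \<Rightarrow> 'a) \<Rightarrow> ('k \<Rightarrow> 'a) \<Rightarrow> bool" where
  "prod_less D \<mu> x y \<longleftrightarrow> eventually (\<lambda>i. (x i, y i) \<in> \<mu> i \<and> x i \<noteq> y i) D"

definition has_tcf ::
  "'x set \<Rightarrow> ('x \<Rightarrow> 'x \<Rightarrow> bool) \<Rightarrow> ('x \<Rightarrow> 'x \<Rightarrow> bool) \<Rightarrow> 'l rel \<Rightarrow> bool" where
  "has_tcf A le lt \<theta> \<longleftrightarrow> regular_cardinal \<theta> \<and>
     (\<exists>F. strict_chain \<theta> A lt F \<and> (\<forall>x\<in>A. \<exists>a\<in>Field \<theta>. le x (F a)))"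

definition ord_fun_less :: "'k filter \<Rightarrow> ('k \<Rightarrow> 'a rel) \<Rightarrow> ('k \<Rightarrow> 'a rel) \<Rightarrow> bool" where
  "ord_fun_less D g f \<longleftrightarrow> eventually (\<lambda>i. g i <o f i) D"

text \<open>
  The norm \<open>\<parallel>f\<parallel>\<^sub>D\<close> is the supremum of the ordinals \<open>\<parallel>g\<parallel>\<^sub>D + 1\<close> for \<open>g <\<^sub>D f\<close>, i.e. the least ordinal
  strictly above all \<open>\<parallel>g\<parallel>\<^sub>D\<close>; the recursion is along \<open><\<^sub>D\<close>, which is well founded when \<open>D\<close> is
  \<open>\<aleph>\<^sub>1\<close>-complete and proper. Only the \<open>g\<close> with values represented on \<open>'a\<close> occur, which
  loses nothing: modulo \<open>D\<close>, each \<open>g <\<^sub>D f\<close> has values isomorphic to initial segments of those of \<open>f\<close>.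
\<close>

definition norm_D :: "'k filter \<Rightarrow> ('k \<Rightarrow> 'a rel) \<Rightarrow> ('k \<Rightarrow> 'a rel) set rel" where
  "norm_D D = wfrec {(g, f). ord_fun_less D g f}
     (\<lambda>N f. least_ord (\<lambda>r. \<forall>g. ord_fun_less D g f \<longrightarrow> N g <o r))"

lemma least_ord:
  assumes "Well_order r" "P r"
  shows "Well_order (least_ord P)" "P (least_ord P)"
    "\<And>s. Well_order s \<Longrightarrow> P s \<Longrightarrow> least_ord P \<le>o s"
proof -
  obtain m where m: "m \<in> {r. Well_order r \<and> P r}"
    "\<And>y. (y, m) \<in> ordLess \<Longrightarrow> y \<notin> {r. Well_order r \<and> P r}"
    using wfE_min[OF wf_ordLess, of r "{r. Well_order r \<and> P r}"] assms by blast
  have "\<exists>r. Well_order r \<and> P r \<and> (\<forall>s. Well_order s \<and> P s \<longrightarrow> r \<le>o s)"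
    using m not_ordLess_iff_ordLeq by blast
  from someI_ex[OF this]
  show "Well_order (least_ord P)" "P (least_ord P)"
    "\<And>s. Well_order s \<Longrightarrow> P s \<Longrightarrow> least_ord P \<le>o s"
    unfolding least_ord_def[symmetric] by blast+
qed

lemma strict_chain_mono:
  assumes "\<nu> \<le>o \<rho>" "strict_chain \<rho> A lt F"
  shows "\<exists>G. strict_chain \<nu> A lt G"
proof -
  obtain e where e: "embed \<nu> \<rho> e" and wo: "Well_order \<nu>" "Well_order \<rho>"
    using assms(1) unfolding ordLeq_def by blast
  have inj: "inj_on e (Field \<nu>)" using embed_inj_on[OF wo(1) e] .
  have comp: "compat \<nu> \<rho> e" using embed_compat[OF e] .
  have fld: "e ` Field \<nu> \<subseteq> Field \<rho>" using embed_Field[OF e] .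
  have "strict_chain \<nu> A lt (F \<circ> e)"
    using assms(2) inj comp fld unfolding strict_chain_def compat_def inj_on_def
    by (auto simp: image_subset_iff) (metis FieldI1 FieldI2)
  then show ?thesis by blast
qed

lemma ordLess_depth_plus_iff:
  fixes A :: "'x set" and \<nu> :: "'n rel"
  assumes irr: "\<And>x. x \<in> A \<Longrightarrow> \<not> lt x x" and wo: "Well_order \<nu>"
  shows "\<nu> <o depth_plus A lt \<longleftrightarrow> (\<exists>F. strict_chain \<nu> A lt F)"
proof -
  let ?P = "\<lambda>\<nu> :: 'x set rel. \<not> (\<exists>F. strict_chain \<nu> A lt F)"
  let ?c = "cardSuc |UNIV :: 'x set|"
  have cw: "Card_order ?c" by (rule cardSuc_Card_order[OF card_of_Card_order])
  then have ww: "Well_order ?c" by (simp add: card_order_on_def)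
  have "?P ?c"
  proof
    assume "\<exists>F. strict_chain ?c A lt F"
    then obtain F where F: "strict_chain ?c A lt F" by blast
    have "inj_on F (Field ?c)"
    proof (rule inj_onI, rule ccontr)
      fix a b assume ab: "a \<in> Field ?c" "b \<in> Field ?c" "F a = F b" "a \<noteq> b"
      then have "(a, b) \<in> ?c \<or> (b, a) \<in> ?c"
        using ww unfolding well_order_on_def linear_order_on_def total_on_def by blast
      then show False using ab F irr unfolding strict_chain_def by metis
    qed
    then have "|Field ?c| \<le>o |UNIV :: 'x set|" using card_of_ordLeq by blast
    then have "?c \<le>o |UNIV :: 'x set|"
      using card_of_Field_ordIso[OF cw] ordIso_symmetric ordIso_ordLeq_trans by blast
    then show False
      using cardSuc_greater[OF card_of_Card_order] not_ordLess_ordLeq by blast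
  qed
  note d = least_ord[of ?c ?P, OF ww this, folded depth_plus_def]
  show ?thesis
  proof
    assume *: "\<nu> <o depth_plus A lt"
    then obtain a where a: "\<nu> =o Restr (depth_plus A lt) (underS (depth_plus A lt) a)"
      using ordLess_iff_ordIso_Restr[OF d(1) wo] by blast
    let ?s = "Restr (depth_plus A lt) (underS (depth_plus A lt) a)"
    have "Well_order ?s" using a ordIso_def by blast
    moreover have "?s <o depth_plus A lt"
      using a * ordIso_symmetric ordIso_ordLess_trans by blast
    ultimately have "\<not> ?P ?s" using d(3) not_ordLess_ordLeq by blast
    then show "\<exists>F. strict_chain \<nu> A lt F"
      using strict_chain_mono a ordIso_iff_ordLeq by blast
  next
    assume *: "\<exists>F. strict_chain \<nu> A lt F"
    show "\<nu> <o depth_plus A lt"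
    proof (rule ccontr)
      assume "\<not> \<nu> <o depth_plus A lt"
      then have "depth_plus A lt \<le>o \<nu>" using wo d(1) not_ordLess_iff_ordLeq by blast
      then show False using * d(2) strict_chain_mono by blast
    qed
  qed
qed

lemma wf_ord_fun_less:
  fixes D :: "'k filter"
  assumes "D \<noteq> bot" "aleph1_complete D"
  shows "wf {(g :: 'k \<Rightarrow> 'a rel, f). ord_fun_less D g f}"
  unfolding wf_iff_no_infinite_down_chain
proof
  assume "\<exists>f. \<forall>n. (f (Suc n), f n) \<in> {(g :: 'k \<Rightarrow> 'a rel, f). ord_fun_less D g f}"
  then obtain f :: "nat \<Rightarrow> 'k \<Rightarrow> 'a rel"
    where "\<forall>n. eventually (\<lambda>i. f (Suc n) i <o f n i) D"
    unfolding ord_fun_less_def by auto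
  then have "eventually (\<lambda>i. \<forall>n. f (Suc n) i <o f n i) D"
    using assms(2)[unfolded aleph1_complete_def, rule_format,
        of "\<lambda>n i. f (Suc n) i <o f n i"] by simp
  then obtain i where "\<forall>n. f (Suc n) i <o f n i"
    using assms(1) eventually_happens' by blast
  then have "\<exists>h. \<forall>n. (h (Suc n), h n) \<in> (ordLess :: 'a rel rel)"
    by (intro exI[of _ "\<lambda>n. f n i"]) simp
  moreover have "wf (ordLess :: 'a rel rel)" by (rule wf_ordLess)
  ultimately show False unfolding wf_iff_no_infinite_down_chain by blast
qed

lemma norm_D_unfold:
  assumes "D \<noteq> bot" "aleph1_complete D"
  shows "norm_D D f = least_ord (\<lambda>r. \<forall>g. ord_fun_less D g f \<longrightarrow> norm_D D g <o r)"
proof -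
  have "norm_D D f = least_ord (\<lambda>r. \<forall>g. ord_fun_less D g f \<longrightarrow>
      cut (norm_D D) {(g, f). ord_fun_less D g f} f g <o r)"
    unfolding norm_D_def by (subst wfrec[OF wf_ord_fun_less[OF assms]]) simp
  also have "\<dots> = least_ord (\<lambda>r. \<forall>g. ord_fun_less D g f \<longrightarrow> norm_D D g <o r)"
    by (rule arg_cong[where f = least_ord]) (auto simp: cut_apply)
  finally show ?thesis .
qed

lemma norm_D:
  fixes f :: "'k \<Rightarrow> 'a rel"
  assumes inf: "infinite (UNIV :: 'k set)" and D: "D \<noteq> bot" "aleph1_complete D"
  shows norm_Well_order: "Well_order (norm_D D f)"
    and norm_greater: "\<And>g. ord_fun_less D g f \<Longrightarrow> norm_D D g <o norm_D D f"
    and norm_least: "\<And>r :: 'r rel. Well_order r \<Longrightarrow>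
      (\<And>g. ord_fun_less D g f \<Longrightarrow> norm_D D g <o r) \<Longrightarrow> norm_D D f \<le>o r"
proof -
  let ?U = "UNIV :: ('k \<Rightarrow> 'a rel) set"
  let ?c = "cardSuc |?U|"
  have infU: "infinite ?U"
  proof -
    have "inj (\<lambda>(k :: 'k) j. if j = k then {} else (UNIV :: 'a rel))"
      by (rule injI) (metis UNIV_not_empty)
    then show ?thesis using inf finite_imageD[of _ "UNIV :: 'k set"] finite_subset[OF subset_UNIV] by blast
  qed
  have cc: "Card_order ?c" by (rule cardSuc_Card_order[OF card_of_Card_order])
  then have cw: "Well_order ?c" by (simp add: card_order_on_def)
  have cinf: "infinite (Field ?c)" using infU cardSuc_finite[OF card_of_Card_order] by (metis Field_card_of)
  have creg: "regularCard ?c"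
    by (rule infinite_cardSuc_regularCard[OF _ card_of_Card_order])
      (simp only: Field_card_of infU not_False_eq_True)
  define B where "B f r \<longleftrightarrow> (\<forall>g. ord_fun_less D g f \<longrightarrow> norm_D D g <o r)"
    for f :: "'k \<Rightarrow> 'a rel" and r :: "('k \<Rightarrow> 'a rel) set rel"
  have unf: "norm_D D f = least_ord (B f)" for f :: "'k \<Rightarrow> 'a rel"
    unfolding B_def by (rule norm_D_unfold[OF D])
  have ex: "norm_D D f <o ?c \<and> (\<exists>r. Well_order r \<and> B f r)" for f :: "'k \<Rightarrow> 'a rel"
  proof (induction f rule: wf_induct_rule[OF wf_ord_fun_less[OF D]])
    case (1 f)
    have "\<exists>a. a \<in> Field ?c \<and> norm_D D g =o Restr ?c (underS ?c a)" if "ord_fun_less D g f" for g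
      using 1[of g] that ordLess_iff_ordIso_Restr[OF cw] unfolding ordLess_def by blast
    then obtain a where a: "\<And>g. ord_fun_less D g f \<Longrightarrow> a g \<in> Field ?c"
      "\<And>g. ord_fun_less D g f \<Longrightarrow> norm_D D g =o Restr ?c (underS ?c (a g))" by metis
    let ?K = "a ` {g. ord_fun_less D g f}"
    have "|?K| \<le>o |?U|"
      using card_of_image card_of_mono1[OF subset_UNIV] ordLeq_transitive by blast
    then have "|?K| <o ?c" using cardSuc_greater[OF card_of_Card_order] ordLeq_ordLess_trans by blast
    then have "\<not> |?K| =o ?c" using not_ordLess_ordIso by blast
    moreover have "?K \<subseteq> Field ?c" using a(1) by auto
    ultimately have "\<not> cofinal ?K ?c" using creg[unfolded regularCard_def, rule_format, of ?K] by metis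
    then obtain b where b: "b \<in> Field ?c" "\<forall>k\<in>?K. b = k \<or> (b, k) \<notin> ?c"
      unfolding cofinal_def by blast
    obtain b' where b': "b' \<in> Field ?c" "b \<noteq> b'" "(b, b') \<in> ?c"
      using infinite_Card_order_limit[OF cc cinf b(1)] by blast
    have wc: "wo_rel ?c" using cw by (simp add: wo_rel_def)
    let ?s = "Restr ?c (underS ?c b')"
    have "norm_D D g <o ?s" if g: "ord_fun_less D g f" for g
    proof -
      have "(a g, b) \<in> ?c" using b(1) b(2)[rule_format, of "a g"] a(1)[OF g] g wo_rel.TOTALS[OF wc] by blast
      then have ab: "(a g, b') \<in> ?c" "a g \<noteq> b'"
        using b' transD[OF wo_rel.TRANS[OF wc]] antisymD[OF wo_rel.ANTISYM[OF wc]] by blast+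
      have "underS ?c (a g) \<subset> underS ?c b'"
        using ab transD[OF wo_rel.TRANS[OF wc]] antisymD[OF wo_rel.ANTISYM[OF wc]] unfolding underS_def by blast
      then have "Restr ?c (underS ?c (a g)) <o ?s"
        using ofilter_subset_ordLess[OF cw wo_rel.underS_ofilter[OF wc] wo_rel.underS_ofilter[OF wc]] by blast
      then show ?thesis using a(2)[OF g] ordIso_ordLess_trans by blast
    qed
    then have s: "B f ?s" unfolding B_def by blast
    have sw: "Well_order ?s" using Well_order_Restr[OF cw] .
    have "norm_D D f \<le>o ?s" unfolding unf using least_ord(3)[of ?s "B f"] s sw by blast
    moreover have "?s <o ?c" using underS_Restr_ordLess[OF cw] b(1) by blast
    ultimately show ?case using s sw ordLeq_ordLess_trans by blast
  qed
  have np: "Well_order (norm_D D f)" "B f (norm_D D f)"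
    "\<And>s. Well_order s \<Longrightarrow> B f s \<Longrightarrow> norm_D D f \<le>o s"
    using ex[of f] least_ord[of _ "B f"] unfolding unf by blast+
  show "Well_order (norm_D D f)" by (rule np)
  show "\<And>g. ord_fun_less D g f \<Longrightarrow> norm_D D g <o norm_D D f"
    using np(2) unfolding B_def by blast
  show "norm_D D f \<le>o r" if r: "Well_order r" "\<And>g. ord_fun_less D g f \<Longrightarrow> norm_D D g <o r"
    for r :: "'r rel"
  proof (rule ccontr)
    assume "\<not> norm_D D f \<le>o r"
    then have less: "r <o norm_D D f" using r(1) np(1) not_ordLess_iff_ordLeq by blast
    then obtain a where a: "r =o Restr (norm_D D f) (underS (norm_D D f) a)" (is "_ =o ?s")
      using ordLess_iff_ordIso_Restr[OF np(1) r(1)] by blast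
    then have "Well_order ?s" unfolding ordIso_def by blast
    moreover have "B f ?s" using r(2) a ordLess_ordIso_trans unfolding B_def by blast
    ultimately have "norm_D D f \<le>o ?s" using np(3) by blast
    then show False
      using less a ordIso_symmetric ordLeq_ordIso_trans not_ordLess_ordLeq by blast
  qed
qed

end

theory Submission
  imports Defs
begin

text \<open>
  Let \<open>f i m\<close> (\<open>m < \<mu> i\<close>) be chains in \<open>\<lambda> i \<rightarrow> \<lambda> i\<close> modulo bounded sets, \<open>\<eta> e\<close> (\<open>e < \<mu>\<close>) a chain
  in the product of the \<open>\<mu> i\<close>, and \<open>g z\<close> (\<open>z < \<lambda>\<close>) a scale in the product of the \<open>\<lambda> i\<close>. Send
  \<open>e\<close> to the function \<open>z \<mapsto> \<parallel>i \<mapsto> f i (\<eta> e i) (g z i)\<parallel>\<^sub>D\<close>, whose values lie below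
  \<open>\<parallel>\<lambda>\<parallel>\<^sub>D = \<lambda>\<close>. For \<open>e < e'\<close> the bounds beyond which \<open>f i (\<eta> e i)\<close> is below \<open>f i (\<eta> e' i)\<close> form
  a point of the product of the \<open>\<lambda> i\<close>, which the scale eventually dominates; from then on the
  strict monotonicity of the norm applies.
\<close>

text \<open>Chains consist of points, while the norm takes relations as values. The segment
  \<open>Restr r (underS r a)\<close> is the ordinal that the point \<open>a\<close> stands for, so
  this lemma and the next one translate between the two orders.\<close>

lemma Restr_underS_strict_mono:
  assumes r: "Well_order r" and ab: "(a, b) \<in> r" "a \<noteq> b"
  shows "Restr r (underS r a) <o Restr r (underS r b)"
proof -
  have w: "wo_rel r" using r by (simp add: wo_rel_def)
  have "underS r a \<subset> underS r b"
    using ab transD[OF wo_rel.TRANS[OF w]] antisymD[OF wo_rel.ANTISYM[OF w]]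
    unfolding underS_def by blast
  then show ?thesis
    using ofilter_subset_ordLess[OF r wo_rel.underS_ofilter[OF w] wo_rel.underS_ofilter[OF w]] by blast
qed

lemma Restr_underS_ordLess_imp:
  assumes r: "Well_order r" and less: "Restr r (underS r a) <o Restr r (underS r b)"
  shows "(b, a) \<notin> r"
proof
  assume ba: "(b, a) \<in> r"
  show False
  proof (cases "a = b")
    case True
    then show False using less ordLess_irreflexive by blast
  next
    case False
    then have "Restr r (underS r b) <o Restr r (underS r a)"
      using Restr_underS_strict_mono[OF r ba] by simp
    then show False using less ordLess_transitive ordLess_irreflexive by blast
  qed
qed

lemma regular_cardinal_Well_order: "regular_cardinal r \<Longrightarrow> Well_order r"
  by (simp add: regular_cardinal_def card_order_on_def)

text \<open>By reflexivity the exceptional set of \<open>f\<close> against itself is all of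
  \<open>Field r\<close>, and an infinite cardinal has no last point to bound it. This is the side
  condition of \<open>ordLess_depth_plus_iff\<close>.\<close>

lemma bd_less_irreflexive:
  assumes r: "regular_cardinal r" and f: "f \<in> Field r \<rightarrow>\<^sub>E Field r"
  shows "\<not> bd_less r f f"
proof
  assume "bd_less r f f"
  then obtain b where b: "b \<in> Field r" "\<And>i. i \<in> Field r \<Longrightarrow> (f i, f i) \<in> r \<Longrightarrow> (i, b) \<in> r"
    unfolding bd_less_def bounded_in_def by blast
  have w: "wo_rel r" using regular_cardinal_Well_order[OF r] by (simp add: wo_rel_def)
  have fr: "(f i, f i) \<in> r" if "i \<in> Field r" for i
    using wo_rel.REFL[OF w] f that unfolding refl_on_def by blast
  obtain b' where "b' \<in> Field r" "b \<noteq> b'" "(b, b') \<in> r"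
    using infinite_Card_order_limit b(1) r unfolding regular_cardinal_def by metis
  then show False using b(2) fr antisymD[OF wo_rel.ANTISYM[OF w]] by blast
qed

lemma ordLess_dp2_plus_iff:
  assumes "regular_cardinal r" and "Well_order \<nu>"
  shows "\<nu> <o dp2_plus r \<longleftrightarrow> (\<exists>F. strict_chain \<nu> (Field r \<rightarrow>\<^sub>E Field r) (bd_less r) F)"
  unfolding dp2_plus_def
  by (rule ordLess_depth_plus_iff) (use assms bd_less_irreflexive in blast)+

lemma not_prod_less_self: "D \<noteq> bot \<Longrightarrow> \<not> prod_less D \<mu> x x"
  by (simp add: prod_less_def)

theorem theorem5p12:
  fixes \<kappa> :: "'k rel" and lams :: "'k \<Rightarrow> 'a rel" and D :: "'k filter" and lam :: "'l rel"
    and mus :: "'k \<Rightarrow> 'm rel" and mu :: "'n rel"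
  assumes "regular_cardinal \<kappa>" and "natLeq <o \<kappa>"
    and "\<And>i. i \<in> Field \<kappa> \<Longrightarrow> regular_cardinal (lams i) \<and> \<kappa> <o lams i"
    and "filter_on D \<kappa>" and "aleph1_complete D"
    and "regular_cardinal lam"
    and "lam =o norm_D D lams"
    and "has_tcf (ord_prod \<kappa> lams) (prod_le D lams) (prod_less D lams) lam"
    and "\<And>i. i \<in> Field \<kappa> \<Longrightarrow> Well_order (mus i) \<and> mus i <o dp2_plus (lams i)"
    and "Well_order mu" and "mu <o depth_plus (ord_prod \<kappa> mus) (prod_less D mus)"
  shows "mu <o dp2_plus lam"
proof -
  note lams = assms(3) and mus = assms(9) and lam = assms(6)
  have D: "D \<noteq> bot" and Fk: "eventually (\<lambda>i. i \<in> Field \<kappa>) D"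
    using assms(4) by (auto simp: filter_on_def)
  have inf: "infinite (UNIV :: 'k set)"
    using assms(1) finite_subset[OF subset_UNIV] unfolding regular_cardinal_def by blast
  have wl: "Well_order lam" using regular_cardinal_Well_order[OF lam] .
  have wls: "Well_order (lams i)" if "i \<in> Field \<kappa>" for i
    using regular_cardinal_Well_order lams[OF that] by blast
  have wol: "wo_rel lam" using wl by (simp add: wo_rel_def)
  have wols: "wo_rel (lams i)" if "i \<in> Field \<kappa>" for i using wls[OF that] by (simp add: wo_rel_def)
  have "\<forall>i\<in>Field \<kappa>. \<exists>F. strict_chain (mus i) (Field (lams i) \<rightarrow>\<^sub>E Field (lams i)) (bd_less (lams i)) F"
    using ordLess_dp2_plus_iff lams mus by blast
  then obtain f where f: "\<And>i. i \<in> Field \<kappa> \<Longrightarrow>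
      strict_chain (mus i) (Field (lams i) \<rightarrow>\<^sub>E Field (lams i)) (bd_less (lams i)) (f i)"
    by metis
  obtain \<eta> where \<eta>: "strict_chain mu (ord_prod \<kappa> mus) (prod_less D mus) \<eta>"
    using assms(11) ordLess_depth_plus_iff[of _ "prod_less D mus", OF not_prod_less_self[OF D] assms(10)]
    by blast
  obtain g where g: "strict_chain lam (ord_prod \<kappa> lams) (prod_less D lams) g"
    and cof: "\<And>x. x \<in> ord_prod \<kappa> lams \<Longrightarrow> \<exists>a\<in>Field lam. prod_le D lams x (g a)"
    using assms(8) unfolding has_tcf_def by blast
  define h where "h e z i = f i (\<eta> e i) (g z i)" for e z i
  \<comment> \<open>Each point \<open>h e z i\<close> becomes the ordinal below it, so that
    \<open>norm_D\<close> applies.\<close>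
  define H where "H e z i = Restr (lams i) (underS (lams i) (h e z i))" for e z i
  have h: "h e z i \<in> Field (lams i)" if "e \<in> Field mu" "z \<in> Field lam" "i \<in> Field \<kappa>" for e z i
  proof -
    have "\<eta> e i \<in> Field (mus i)" "g z i \<in> Field (lams i)"
      using \<eta> g that unfolding strict_chain_def ord_prod_def by (blast dest: PiE_mem)+
    then show ?thesis using f[OF that(3)] unfolding strict_chain_def h_def by (blast dest: PiE_mem)
  qed
  \<comment> \<open>\<open>H e z\<close> lies below \<open>lams\<close> modulo \<open>D\<close>, so
    its norm is less than \<open>lam\<close> and is named by a point of \<open>lam\<close>; these
    points are the values of the new chain.\<close>
  have "\<exists>c. c \<in> Field lam \<and> norm_D D (H e z) =o Restr lam (underS lam c)"
    if ez: "e \<in> Field mu" "z \<in> Field lam" for e z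
  proof -
    have "ord_fun_less D (H e z) lams"
      unfolding ord_fun_less_def using Fk
    proof eventually_elim
      case (elim i)
      then show ?case using underS_Restr_ordLess[OF wls] h[OF ez] unfolding H_def by blast
    qed
    then have "norm_D D (H e z) <o norm_D D lams"
      by (rule norm_greater[OF inf D assms(5)])
    then have less: "norm_D D (H e z) <o lam"
      using ordLess_ordIso_trans ordIso_symmetric[OF assms(7)] by blast
    then show ?thesis
      using ordLess_iff_ordIso_Restr[OF wl norm_Well_order[OF inf D assms(5)]] by blast
  qed
  then obtain c where c: "\<And>e z. e \<in> Field mu \<Longrightarrow> z \<in> Field lam \<Longrightarrow> c e z \<in> Field lam"
    "\<And>e z. e \<in> Field mu \<Longrightarrow> z \<in> Field lam \<Longrightarrow>
      norm_D D (H e z) =o Restr lam (underS lam (c e z))"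
    by metis
  have "bd_less lam (restrict (c e) (Field lam)) (restrict (c e') (Field lam))"
    if ee: "(e, e') \<in> mu" "e \<noteq> e'" for e e'
  proof -
    have e: "e \<in> Field mu" "e' \<in> Field mu" using ee by (auto intro: FieldI1 FieldI2)
    have \<eta>e: "eventually (\<lambda>i. (\<eta> e i, \<eta> e' i) \<in> mus i \<and> \<eta> e i \<noteq> \<eta> e' i) D"
      using \<eta> ee unfolding strict_chain_def prod_less_def by blast
    \<comment> \<open>Such a \<open>b\<close> bounds the places where
      \<open>f i (\<eta> e i)\<close> fails to be below \<open>f i (\<eta> e' i)\<close>. It is
      guaranteed only where \<open>\<eta>\<close> increases from \<open>e\<close> to
      \<open>e'\<close>, that is, on a set in \<open>D\<close>.\<close>
    define P where "P i b \<longleftrightarrow> b \<in> Field (lams i) \<and>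
        (\<forall>j\<in>Field (lams i). (f i (\<eta> e' i) j, f i (\<eta> e i) j) \<in> lams i \<longrightarrow> (j, b) \<in> lams i)" for i b
    have ex: "\<exists>b. P i b" if "i \<in> Field \<kappa>" "(\<eta> e i, \<eta> e' i) \<in> mus i" "\<eta> e i \<noteq> \<eta> e' i" for i
      using f that unfolding P_def strict_chain_def bd_less_def bounded_in_def by blast
    \<comment> \<open>The second disjunct only serves to keep \<open>b\<close> in the product off the \<open>D\<close>-large set.\<close>
    have "\<forall>i\<in>Field \<kappa>. \<exists>b. b \<in> Field (lams i) \<and> (P i b \<or> (\<nexists>b. P i b))"
    proof
      fix i assume "i \<in> Field \<kappa>"
      then have "Field (lams i) \<noteq> {}" using lams unfolding regular_cardinal_def by fastforce
      then show "\<exists>b. b \<in> Field (lams i) \<and> (P i b \<or> (\<nexists>b. P i b))" unfolding P_def by blast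
    qed
    then obtain b where b: "\<And>i. i \<in> Field \<kappa> \<Longrightarrow> b i \<in> Field (lams i)"
      "\<And>i. i \<in> Field \<kappa> \<Longrightarrow> P i (b i) \<or> (\<nexists>b. P i b)" by metis
    have "restrict b (Field \<kappa>) \<in> ord_prod \<kappa> lams" unfolding ord_prod_def using b(1) by auto
    \<comment> \<open>The index \<open>a\<close> at which the scale dominates the local bounds will
      bound the exceptional set in \<open>lam\<close>.\<close>
    then obtain a where a: "a \<in> Field lam" "prod_le D lams (restrict b (Field \<kappa>)) (g a)"
      using cof by blast
    have "(z, a) \<in> lam" if z: "z \<in> Field lam" "(c e' z, c e z) \<in> lam" for z
    proof (rule ccontr)
      assume "(z, a) \<notin> lam"
      then have "(a, z) \<in> lam" "a \<noteq> z" using wo_rel.TOTALS[OF wol] wo_rel.REFL[OF wol] a(1) z(1)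
        unfolding refl_on_def by blast+
      then have "prod_less D lams (g a) (g z)" using g unfolding strict_chain_def by blast
      then have "ord_fun_less D (H e z) (H e' z)"
        using Fk \<eta>e a(2) unfolding ord_fun_less_def prod_less_def prod_le_def
      proof eventually_elim
        case (elim i)
        have i: "i \<in> Field \<kappa>" by (rule elim)
        have Pb: "P i (b i)" using ex b(2) elim by blast
        have "(b i, g a i) \<in> lams i" using elim by simp
        \<comment> \<open>Since \<open>z\<close> is past \<open>a\<close>, \<open>g z i\<close> is
          strictly above \<open>g a i\<close>, hence strictly above the local bound
          \<open>b i\<close>, and so outside the local exceptional set.\<close>
        then have "(g z i, b i) \<notin> lams i"
          using elim transD[OF wo_rel.TRANS[OF wols[OF i]]] antisymD[OF wo_rel.ANTISYM[OF wols[OF i]]]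
          by blast
        moreover have "g z i \<in> Field (lams i)" using elim by (blast intro: FieldI2)
        ultimately have n: "(h e' z i, h e z i) \<notin> lams i" using Pb unfolding P_def h_def by blast
        then have "(h e z i, h e' z i) \<in> lams i" "h e z i \<noteq> h e' z i"
          using wo_rel.TOTALS[OF wols[OF i]] wo_rel.REFL[OF wols[OF i]] h[OF _ z(1) i] e
          unfolding refl_on_def by metis+
        then show ?case unfolding H_def by (rule Restr_underS_strict_mono[OF wls[OF i]])
      qed
      then have "norm_D D (H e z) <o norm_D D (H e' z)" by (rule norm_greater[OF inf D assms(5)])
      \<comment> \<open>The inequality of norms passes to the segments below \<open>c e z\<close>
        and \<open>c e' z\<close>, against the choice of \<open>z\<close> in the exceptional
        set.\<close>
      then have "Restr lam (underS lam (c e z)) <o Restr lam (underS lam (c e' z))"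
        using c(2)[OF e(1) z(1)] c(2)[OF e(2) z(1)] ordIso_symmetric ordIso_ordLess_trans
          ordLess_ordIso_trans by blast
      then show False using Restr_underS_ordLess_imp[OF wl] z(2) by blast
    qed
    then show ?thesis unfolding bd_less_def bounded_in_def using a(1) by auto
  qed
  then have "strict_chain mu (Field lam \<rightarrow>\<^sub>E Field lam) (bd_less lam) (\<lambda>e. restrict (c e) (Field lam))"
    unfolding strict_chain_def using c(1) by auto
  then show ?thesis using ordLess_dp2_plus_iff[OF lam assms(10)] by blast
qed

end
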